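(* Let $A$ be a nonempty finite set, for each $i \in \mathbb{N}$ let $X_i$ be a Polish space, let $X = \prod_{i\in\mathbb{N}} X_i$ with the product topology, and let $u : A \times X \to \mathbb{R}$ be a bounded Borel-measurable function. Let $\Sigma$ be the set of all product Borel probability measures $\sigma = \bigotimes_{i\in\mathbb{N}}\sigma_i$ on $X$ (with $\sigma_i$ a Borel probability measure on $X_i$ for each $i$), and let $\Sigma^* \subseteq \Sigma$ be the set of those $\sigma = \bigotimes_{i\in\mathbb{N}}\sigma_i$ for which $\sigma_i$ is a Dirac measure on $X_i$ for all but finitely many $i \in \mathbb{N}$. Define $$v = \inf_{\sigma\in\Sigma}\max_{a\in A}\mathbb{E}_{a\otimes\sigma}[u], \qquad v^* = \inf_{\sigma\in\Sigma^*}\max_{a\in A}\mathbb{E}_{a\otimes\sigma}[u].$$ Then $v = v^*$.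
   Context: $\mathbb{N} = \{1,2,\ldots\}$. For $a \in A$ and $\sigma \in \Sigma$, $\mathbb{E}_{a\otimes\sigma}[u]$ is the expectation of $u$ under the product of the Dirac measure at $a$ and $\sigma$, i.e. $\mathbb{E}_{a\otimes\sigma}[u] = \int_X u(a,x)\,\sigma(dx)$. The finite set $A$ carries the discrete topology. Interpretation: in the strategic-form game with player set $\{0\}\cup\mathbb{N}$, $A$ is the action set of player $0$, $X_i$ is the action set of player $i \in \mathbb{N}$, and $u$ is player $0$'s payoff function; $v$ is called the minmax value and $v^*$ the finitistic minmax value of player $0$. *)

theory Defs
  imports "HOL-Probability.Probability"
begin

definition polish_space :: "'x topology \<Rightarrow> bool" where
  "polish_space T \<longleftrightarrow> completely_metrizable_space T \<and> separable_space T"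

definition borel_of :: "'x topology \<Rightarrow> 'x measure" where
  "borel_of T = sigma (topspace T) {U. openin T U}"

definition borel_prob_measures :: "'x topology \<Rightarrow> 'x measure set" where
  "borel_prob_measures T = {M. prob_space M \<and> sets M = sets (borel_of T)}"

definition dirac_measures :: "'x topology \<Rightarrow> 'x measure set" where
  "dirac_measures T = {return (borel_of T) x | x. x \<in> topspace T}"

text \<open>
  The family of spaces is indexed by all of \<^typ>\<open>nat\<close>, which only relabels the index set
  \<open>{1, 2, \<dots>}\<close>.  Using topologies on a common carrier type lets the spaces differ from
  one index to another.  The measure \<open>PiM UNIV s\<close> lives on the product sigma-algebra, which for
  Polish factors is the Borel sigma-algebra of the product topology
  (lemma \<open>sets_PiM_eq_borel_of_product\<close> below).
\<close>

definition product_measures :: "(nat \<Rightarrow> 'x topology) \<Rightarrow> (nat \<Rightarrow> 'x) measure set" where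
  "product_measures X = {PiM UNIV s | s. \<forall>i. s i \<in> borel_prob_measures (X i)}"

definition finitistic_product_measures ::
    "(nat \<Rightarrow> 'x topology) \<Rightarrow> (nat \<Rightarrow> 'x) measure set" where
  "finitistic_product_measures X =
     {PiM UNIV s | s. (\<forall>i. s i \<in> borel_prob_measures (X i)) \<and>
                      finite {i. s i \<notin> dirac_measures (X i)}}"

definition expected_payoff :: "'a set \<Rightarrow> ('a \<times> 'y \<Rightarrow> real) \<Rightarrow> 'a \<Rightarrow> 'y measure \<Rightarrow> real" where
  "expected_payoff A u a \<sigma> =
     (\<integral>z. u z \<partial>(return (borel_of (discrete_topology A)) a \<Otimes>\<^sub>M \<sigma>))"

definition minmax_value ::
    "'a set \<Rightarrow> (nat \<Rightarrow> 'x topology) \<Rightarrow> ('a \<times> (nat \<Rightarrow> 'x) \<Rightarrow> real) \<Rightarrow> real" where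
  "minmax_value A X u =
     (INF \<sigma>\<in>product_measures X. MAX a\<in>A. expected_payoff A u a \<sigma>)"

definition finitistic_minmax_value ::
    "'a set \<Rightarrow> (nat \<Rightarrow> 'x topology) \<Rightarrow> ('a \<times> (nat \<Rightarrow> 'x) \<Rightarrow> real) \<Rightarrow> real" where
  "finitistic_minmax_value A X u =
     (INF \<sigma>\<in>finitistic_product_measures X. MAX a\<in>A. expected_payoff A u a \<sigma>)"

subsection \<open>Consistency of the measurable structures\<close>

lemma space_borel_of [simp]: "space (borel_of T) = topspace T"
  unfolding borel_of_def by (rule space_measure_of) (auto dest: openin_subset)

lemma sets_borel_of: "sets (borel_of T) = sigma_sets (topspace T) {U. openin T U}"
  unfolding borel_of_def by (rule sets_measure_of) (auto dest: openin_subset)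

lemma openin_in_sets_borel_of: "openin T U \<Longrightarrow> U \<in> sets (borel_of T)"
  by (simp add: sets_borel_of sigma_sets.Basic)

lemma continuous_map_measurable_borel_of:
  assumes "continuous_map S T f"
  shows "f \<in> borel_of S \<rightarrow>\<^sub>M borel_of T"
proof (rule measurable_sigma_sets[OF sets_borel_of])
  show "{U. openin T U} \<subseteq> Pow (topspace T)"
    by (auto dest: openin_subset)
  show "f \<in> space (borel_of S) \<rightarrow> topspace T"
    using assms by (auto simp: continuous_map_def)
  fix U assume "U \<in> {U. openin T U}"
  then have "openin S {x \<in> topspace S. f x \<in> U}"
    using assms by (auto simp: continuous_map_def)
  moreover have "f -` U \<inter> space (borel_of S) = {x \<in> topspace S. f x \<in> U}"
    by auto
  ultimately show "f -` U \<inter> space (borel_of S) \<in> sets (borel_of S)"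
    by (simp add: openin_in_sets_borel_of)
qed

lemma polish_space_imp_second_countable:
  assumes "polish_space T"
  shows "second_countable T"
proof -
  obtain M d C where M: "Metric_space M d" and T: "T = Metric_space.mtopology M d"
    and C: "countable C" "C \<subseteq> topspace T" "T closure_of C = topspace T"
    using assms unfolding polish_space_def completely_metrizable_space_def separable_space_def
    by blast
  interpret Metric_space M d by (rule M)
  define \<B> where "\<B> = (\<lambda>(c, n). mball c (inverse (real (Suc n)))) ` (C \<times> UNIV)"
  show ?thesis
    unfolding second_countable_def
  proof (intro exI conjI allI impI ballI)
    show "countable \<B>"
      using C(1) by (auto simp: \<B>_def)
    show "openin T V" if "V \<in> \<B>" for V
      using that by (auto simp: \<B>_def T)
    fix U x assume U: "openin T U \<and> x \<in> U"
    then obtain r where r: "r > 0" "mball x r \<subseteq> U" and x: "x \<in> M"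
      unfolding T openin_mtopology by blast
    obtain n where n: "inverse (real (Suc n)) < r / 2"
      using reals_Archimedean r(1) half_gt_zero by blast
    let ?e = "inverse (real (Suc n))"
    have "x \<in> T closure_of C"
      using x C(3) T by simp
    then obtain c where c: "c \<in> C" "c \<in> mball x ?e"
      unfolding T metric_closure_of
      by (smt (verit) inverse_positive_iff_positive of_nat_0_less_iff zero_less_Suc mem_Collect_eq)
    then have "x \<in> mball c ?e" "c \<in> M"
      by (auto simp: commute)
    moreover have "mball c ?e \<subseteq> mball x r"
    proof
      fix y assume y: "y \<in> mball c ?e"
      then have "d x y \<le> d x c + d c y"
        using x by (auto intro: triangle)
      then show "y \<in> mball x r"
        using y c(2) n x by auto
    qed
    moreover have "mball c ?e \<in> \<B>"
      using c(1) by (auto simp: \<B>_def)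
    ultimately show "\<exists>V\<in>\<B>. x \<in> V \<and> V \<subseteq> U"
      using r(2) by blast
  qed
qed

lemma sets_PiM_eq_borel_of_product:
  fixes X :: "nat \<Rightarrow> 'x topology"
  assumes X: "\<And>i. polish_space (X i)"
    and s: "\<And>i. sets (s i) = sets (borel_of (X i))"
  shows "sets (PiM UNIV s) = sets (borel_of (product_topology X UNIV))"
proof -
  let ?P = "PiM UNIV (\<lambda>i. borel_of (X i))" and ?B = "borel_of (product_topology X UNIV)"
  have "sets (PiM UNIV s) = sets ?P"
    by (rule sets_PiM_cong) (auto simp: s)
  also have "sets ?P = sets ?B"
  proof
    have "(\<lambda>x i. x i) \<in> ?B \<rightarrow>\<^sub>M ?P"
    proof (rule measurable_PiM_single')
      show "(\<lambda>x. x i) \<in> ?B \<rightarrow>\<^sub>M borel_of (X i)" for i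
        by (intro continuous_map_measurable_borel_of continuous_map_product_projection) simp
    qed auto
    then have id: "(\<lambda>x. x) \<in> ?B \<rightarrow>\<^sub>M ?P"
      by simp
    show "sets ?P \<subseteq> sets ?B"
    proof
      fix W assume W: "W \<in> sets ?P"
      have "W \<subseteq> space ?B"
        using sets.sets_into_space[OF W] by (simp add: space_PiM)
      then have "(\<lambda>x. x) -` W \<inter> space ?B = W"
        by auto
      then show "W \<in> sets ?B"
        using measurable_sets[OF id W] by simp
    qed
    have "\<exists>b::nat \<Rightarrow> 'x set. (\<forall>n. openin (X i) (b n)) \<and>
            (\<forall>U x. openin (X i) U \<and> x \<in> U \<longrightarrow> (\<exists>n. x \<in> b n \<and> b n \<subseteq> U))" for i
    proof -
      obtain \<B> where \<B>: "countable \<B>" "\<And>V. V \<in> \<B> \<Longrightarrow> openin (X i) V"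
        "\<And>U x. openin (X i) U \<Longrightarrow> x \<in> U \<Longrightarrow> \<exists>V \<in> \<B>. x \<in> V \<and> V \<subseteq> U"
        using polish_space_imp_second_countable[OF X] unfolding second_countable_def by meson
      have range: "range (from_nat_into (insert {} \<B>)) = insert {} \<B>"
        using \<B>(1) by (intro range_from_nat_into) auto
      have "openin (X i) (from_nat_into (insert {} \<B>) n)" for n
        using from_nat_into[of "insert {} \<B>" n] \<B>(2) openin_empty by auto
      moreover have "\<exists>n. x \<in> from_nat_into (insert {} \<B>) n \<and> from_nat_into (insert {} \<B>) n \<subseteq> U"
        if Ux: "openin (X i) U" "x \<in> U" for U x
      proof -
        obtain V where V: "V \<in> \<B>" "x \<in> V" "V \<subseteq> U"
          using \<B>(3)[OF Ux] by blast
        then have "V \<in> range (from_nat_into (insert {} \<B>))"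
          using range by simp
        then show ?thesis
          using V(2,3) by blast
      qed
      ultimately show ?thesis
        by blast
    qed
    then obtain b :: "nat \<Rightarrow> nat \<Rightarrow> 'x set" where b: "\<And>i n. openin (X i) (b i n)"
      "\<And>i U x. openin (X i) U \<Longrightarrow> x \<in> U \<Longrightarrow> \<exists>n. x \<in> b i n \<and> b i n \<subseteq> U"
      by metis
    define box where
      "box l = (\<Pi>\<^sub>E i\<in>UNIV. if i < length l then b i (l ! i) else topspace (X i))" for l
    have box: "box l \<in> sets ?P" for l
      unfolding box_def by (rule sets_PiM_I_countable) (auto intro: openin_in_sets_borel_of b)
    have open_PiM: "U \<in> sets ?P" if U: "openin (product_topology X UNIV) U" for U
    proof -
      have "\<exists>l. x \<in> box l \<and> box l \<subseteq> U" if x: "x \<in> U" for x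
      proof -
        obtain V where V: "finite {i. V i \<noteq> topspace (X i)}" "\<And>i. openin (X i) (V i)"
          "x \<in> Pi\<^sub>E UNIV V" "Pi\<^sub>E UNIV V \<subseteq> U"
          using U x unfolding openin_product_topology_alt by fastforce
        obtain N where N: "\<And>i. V i \<noteq> topspace (X i) \<Longrightarrow> i < N"
          using V(1) finite_nat_set_iff_bounded by auto
        have "\<exists>n. x i \<in> b i n \<and> b i n \<subseteq> V i" for i
          using b(2)[OF V(2)] PiE_mem[OF V(3) UNIV_I] by blast
        then obtain f where f: "\<And>i. x i \<in> b i (f i)" "\<And>i. b i (f i) \<subseteq> V i"
          by metis
        have "x \<in> box (map f [0..<N])"
          using f(1) subsetD[OF openin_subset[OF V(2)] PiE_mem[OF V(3) UNIV_I]]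
          by (auto simp: box_def)
        moreover have "box (map f [0..<N]) \<subseteq> Pi\<^sub>E UNIV V"
          unfolding box_def
        proof (rule PiE_mono)
          fix i
          show "(if i < length (map f [0..<N]) then b i (map f [0..<N] ! i) else topspace (X i))
                \<subseteq> V i"
            using f(2)[of i] N[of i] by (cases "i < N") auto
        qed
        ultimately show ?thesis
          using V(4) by blast
      qed
      then have "U = (\<Union>l\<in>{l. box l \<subseteq> U}. box l)"
        by blast
      moreover have "(\<Union>l\<in>{l. box l \<subseteq> U}. box l) \<in> sets ?P"
        by (rule sets.countable_UN'') (auto intro: box)
      ultimately show ?thesis
        by simp
    qed
    show "sets ?B \<subseteq> sets ?P"
      unfolding sets_borel_of
      using sets.sigma_sets_subset[of "{U. openin (product_topology X UNIV) U}" ?P] open_PiM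
      by (auto simp: space_PiM)
  qed
  finally show ?thesis .
qed

lemma expected_payoff_eq:
  assumes A: "finite A" "a \<in> A"
    and X: "\<And>i. polish_space (X i)"
    and u: "u \<in> borel_measurable
                 (borel_of (prod_topology (discrete_topology A) (product_topology X UNIV)))"
    and bdd: "bounded (u ` (A \<times> topspace (product_topology X UNIV)))"
    and \<sigma>: "\<sigma> \<in> product_measures X"
  shows "expected_payoff A u a \<sigma> = (\<integral>x. u (a, x) \<partial>\<sigma>)"
proof -
  let ?D = "borel_of (discrete_topology A)" and ?T = "product_topology X UNIV"
  obtain s where s: "\<sigma> = PiM UNIV s" "\<And>i. prob_space (s i)" "\<And>i. sets (s i) = sets (borel_of (X i))"
    using \<sigma> unfolding product_measures_def borel_prob_measures_def by auto
  interpret \<sigma>: prob_space \<sigma>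
    unfolding s(1) by (rule prob_space_PiM) (rule s(2))
  have a: "a \<in> space ?D"
    using A by simp
  interpret D: prob_space "return ?D a"
    by (rule prob_space_return) (rule a)
  interpret P: pair_prob_space "return ?D a" \<sigma> ..
  have sets_\<sigma>: "sets \<sigma> = sets (borel_of ?T)"
    unfolding s(1) by (rule sets_PiM_eq_borel_of_product) (auto simp: X s(3))
  have space_\<sigma>: "space \<sigma> = topspace ?T"
    using sets_eq_imp_space_eq[OF sets_\<sigma>] by (simp del: topspace_product_topology)
  have slice: "(\<lambda>x. u (c, x)) \<in> borel_measurable \<sigma>" if c: "c \<in> A" for c
  proof -
    have "continuous_map ?T (prod_topology (discrete_topology A) ?T) (\<lambda>x. (c, x))"
      using c by (intro continuous_map_pairedI) auto
    then have "(\<lambda>x. u (c, x)) \<in> borel_measurable (borel_of ?T)"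
      using measurable_compose[OF continuous_map_measurable_borel_of u] by blast
    then show ?thesis
      using measurable_cong_sets[OF sets_\<sigma> refl] by blast
  qed
  let ?M = "return ?D a \<Otimes>\<^sub>M \<sigma>"
  have meas: "u \<in> borel_measurable ?M"
  proof (rule measurableI)
    fix W :: "real set" assume W: "W \<in> sets borel"
    have "u -` W \<inter> space ?M = (\<Union>c\<in>A. {c} \<times> ((\<lambda>x. u (c, x)) -` W \<inter> space \<sigma>))"
      by (auto simp: space_pair_measure)
    also have "\<dots> \<in> sets ?M"
      using A(1) slice W
      by (intro sets.finite_UN pair_measureI measurable_sets[OF slice W])
         (auto intro: openin_in_sets_borel_of)
    finally show "u -` W \<inter> space ?M \<in> sets ?M" .
  qed simp
  obtain C where "\<And>z. z \<in> A \<times> topspace ?T \<Longrightarrow> norm (u z) \<le> C"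
    using bdd unfolding bounded_iff by blast
  then have int: "integrable ?M u"
    by (intro P.P.integrable_const_bound[where B=C] meas AE_I2)
       (simp add: space_pair_measure space_\<sigma> del: topspace_product_topology)
  have "expected_payoff A u a \<sigma> = (\<integral>c. (\<integral>x. u (c, x) \<partial>\<sigma>) \<partial>return ?D a)"
    unfolding expected_payoff_def by (rule P.integral_fst'[symmetric, OF int])
  also have "\<dots> = (\<integral>x. u (a, x) \<partial>\<sigma>)"
    using \<sigma>.borel_measurable_lebesgue_integral[of "\<lambda>c x. u (c, x)" "return ?D a"] meas
    by (intro integral_return a) simp
  finally show ?thesis .
qed

end

theory Submission
  imports Defs
begin

text \<open>
  The inequality \<open>v \<le> v\<^sup>*\<close> holds because \<open>v\<^sup>*\<close> is an infimum over fewer measures.  For the converse, a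
  product measure \<open>\<sigma> = \<Otimes>\<^sub>i \<sigma>\<^sub>i\<close> is replaced by one of the form
  \<open>\<Otimes>\<^sub>i\<^sub>\<in>\<^sub>J \<sigma>\<^sub>i \<otimes> \<Otimes>\<^sub>i\<^sub>\<notin>\<^sub>J \<delta>\<^sub>y\<^sub>i\<close> with \<open>J\<close> finite, in such a way that the expectations of all
  the finitely many functions \<open>u\<^sub>a = u(a, \<cdot>)\<close> change by less than a given \<open>e\<close>.

  Each \<open>u\<^sub>a\<close> is close in \<open>L\<^sup>1(\<sigma>)\<close> to a function \<open>g\<^sub>a\<close> of the coordinates in a finite set, and since
  there are finitely many actions, one finite set \<open>J\<close> serves them all
  (\<open>integrable_imp_finitely_approximable\<close>).  Fixing the coordinates outside \<open>J\<close> at a point \<open>y\<close> does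
  not change the expectation of \<open>g\<^sub>a\<close> at all, so only the error \<open>w = \<Sum>\<^sub>a |u\<^sub>a - g\<^sub>a|\<close> has to be
  controlled.  If \<open>x\<close> and \<open>y\<close> are independent with law \<open>\<sigma>\<close>, the point that agrees with \<open>x\<close> on \<open>J\<close> and
  with \<open>y\<close> off \<open>J\<close> has law \<open>\<sigma>\<close> again (\<open>distr_override_on_pair\<close>).  By Fubini, the average over \<open>y\<close> of
  the error after fixing is therefore the original small error \<open>\<integral> w d\<sigma>\<close>, so some \<open>y\<close> makes it
  small for all actions at once (\<open>exists_point_freezing_preserves_expectations\<close>).  For that \<open>y\<close>, the
  law of the spliced point is the required product measure (\<open>distr_override_on_fixed\<close>).
\<close>

section \<open>Splicing two points of a product space\<close>

context product_prob_space
begin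

lemma override_on_in_space_PiM:
  assumes "x \<in> space (PiM I M)" and "y \<in> space (PiM I M)"
  shows "override_on y x J \<in> space (PiM I M)"
  using assms by (auto simp: space_PiM PiE_iff override_on_def extensional_def)

lemma measurable_override_on [measurable]:
  "(\<lambda>p. override_on (fst p) (snd p) J) \<in> PiM I M \<Otimes>\<^sub>M PiM I M \<rightarrow>\<^sub>M PiM I M"
proof (rule measurable_PiM_single')
  fix i assume "i \<in> I"
  then show "(\<lambda>p. override_on (fst p) (snd p) J i) \<in> PiM I M \<Otimes>\<^sub>M PiM I M \<rightarrow>\<^sub>M M i"
    by (cases "i \<in> J") simp_all
qed (auto simp: space_pair_measure space_PiM PiE_iff override_on_def extensional_def)

lemma measurable_override_on_fixed:
  assumes "y \<in> space (PiM I M)"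
  shows "(\<lambda>x. override_on y x J) \<in> PiM I M \<rightarrow>\<^sub>M PiM I M"
  using measurable_compose[OF measurable_Pair1'[OF assms, of "PiM I M"] measurable_override_on[of J]]
  by simp

text \<open>
  The coordinates are independent, so it does not matter whether a coordinate is read off \<open>x\<close> or off
  an independent copy \<open>y\<close>: a finite cylinder pulls back to a rectangle whose sides are the cylinders
  over \<open>K - J\<close> and \<open>K \<inter> J\<close>.
\<close>

lemma distr_override_on_pair:
  "distr (PiM I M \<Otimes>\<^sub>M PiM I M) (PiM I M) (\<lambda>p. override_on (fst p) (snd p) J) = PiM I M"
    (is "?D = _")
proof (rule PiM_eq)
  fix K F assume K: "finite K" "K \<subseteq> I" and F: "\<And>j. j \<in> K \<Longrightarrow> F j \<in> sets (M j)"
  let ?P = "PiM I M" and ?f = "\<lambda>p. override_on (fst p) (snd p) J"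
  let ?C = "\<lambda>L. prod_emb I M L (Pi\<^sub>E L F)"
  have C: "?C L \<in> sets ?P" if "L \<subseteq> K" for L
    using that K F by (intro sets_PiM_I) (auto intro: finite_subset)
  have eq: "?f -` ?C K \<inter> space (?P \<Otimes>\<^sub>M ?P) = ?C (K - J) \<times> ?C (K \<inter> J)"
    by (auto simp: space_pair_measure space_PiM prod_emb_def PiE_iff override_on_def extensional_def
        split: if_splits)
  have "emeasure ?D (?C K) = emeasure (?P \<Otimes>\<^sub>M ?P) (?C (K - J) \<times> ?C (K \<inter> J))"
    by (simp add: emeasure_distr C eq)
  also have "\<dots> = emeasure ?P (?C (K - J)) * emeasure ?P (?C (K \<inter> J))"
    by (intro P.emeasure_pair_measure_Times C) auto
  also have "\<dots> = (\<Prod>j\<in>K - J. emeasure (M j) (F j)) * (\<Prod>j\<in>K \<inter> J. emeasure (M j) (F j))"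
    using K F by (subst (1 2) emeasure_PiM_emb) auto
  also have "\<dots> = (\<Prod>j\<in>K. emeasure (M j) (F j))"
    unfolding prod.Int_Diff[OF K(1), of _ J] by (rule mult.commute)
  finally show "emeasure ?D (?C K) = (\<Prod>j\<in>K. emeasure (M j) (F j))" .
qed simp

text \<open>
  Fixing \<open>y\<close> turns each factor outside \<open>J\<close> into a Dirac measure, which is how finitistic product
  measures arise.  The measures are again compared on finite cylinders; one whose constraints
  outside \<open>J\<close> fail at \<open>y\<close> has empty preimage.
\<close>

lemma distr_override_on_fixed:
  assumes y: "y \<in> space (PiM I M)"
  shows "distr (PiM I M) (PiM I M) (\<lambda>x. override_on y x J) =
         PiM I (\<lambda>i. if i \<in> J then M i else return (M i) (y i))" (is "?D = PiM I ?N")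
proof -
  let ?P = "PiM I M"
  have yi: "y i \<in> space (M i)" if "i \<in> I" for i
    using y that by (auto simp: space_PiM)
  have sets_N: "sets (PiM I ?N) = sets ?P"
    by (rule sets_PiM_cong) auto
  have emb_N: "prod_emb I ?N K X = prod_emb I M K X" for K X
    by (simp add: prod_emb_def if_distrib cong: if_cong)
  show ?thesis
  proof (rule measure_eqI_PiM_infinite)
    show "finite_measure ?D"
      by (intro prob_space.finite_measure prob_space_distr measurable_override_on_fixed y)
  next
    fix F K assume K: "finite K" "K \<subseteq> I" and F: "\<And>j. j \<in> K \<Longrightarrow> F j \<in> sets (?N j)"
    have F': "F j \<in> sets (M j)" if "j \<in> K" for j
      using F[OF that] by (simp split: if_splits)
    let ?C = "\<lambda>L. prod_emb I M L (Pi\<^sub>E L F)"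
    have C: "?C L \<in> sets ?P" if "L \<subseteq> K" for L
      using that K F' by (intro sets_PiM_I) (auto intro: finite_subset)
    have eq: "(\<lambda>x. override_on y x J) -` ?C K \<inter> space ?P =
        (if \<forall>j\<in>K - J. y j \<in> F j then ?C (K \<inter> J) else {})"
    proof (rule set_eqI)
      fix x
      have mem: "z \<in> ?C L \<longleftrightarrow> z \<in> space ?P \<and> (\<forall>j\<in>L. z j \<in> F j)" for L z
        by (auto simp: prod_emb_def space_PiM PiE_iff)
      have "(\<forall>j\<in>K. override_on y x J j \<in> F j) \<longleftrightarrow>
          (\<forall>j\<in>K \<inter> J. x j \<in> F j) \<and> (\<forall>j\<in>K - J. y j \<in> F j)"
        by (auto simp: override_on_def)
      then show "x \<in> (\<lambda>x. override_on y x J) -` ?C K \<inter> space ?P \<longleftrightarrow>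
          x \<in> (if \<forall>j\<in>K - J. y j \<in> F j then ?C (K \<inter> J) else {})"
        using override_on_in_space_PiM[OF _ y, of x J]
        by (auto simp: mem simp del: override_on_apply_in override_on_apply_notin)
    qed
    have "emeasure ?D (?C K) =
        (\<Prod>j\<in>K \<inter> J. emeasure (M j) (F j)) * (\<Prod>j\<in>K - J. indicator (F j) (y j))"
    proof (cases "\<forall>j\<in>K - J. y j \<in> F j")
      case True
      moreover have "emeasure ?P (?C (K \<inter> J)) = (\<Prod>j\<in>K \<inter> J. emeasure (M j) (F j))"
        using K F' by (intro emeasure_PiM_emb) auto
      ultimately show ?thesis
        by (simp add: emeasure_distr measurable_override_on_fixed y C eq)
    next
      case False
      then obtain j where "j \<in> K - J" "y j \<notin> F j"
        by blast
      then have "(\<Prod>j\<in>K - J. indicator (F j) (y j) :: ennreal) = 0"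
        using K(1) by (intro prod_zero bexI[of _ j]) auto
      then show ?thesis
        using False by (auto simp: emeasure_distr measurable_override_on_fixed y C eq)
    qed
    also have "\<dots> = (\<Prod>j\<in>K \<inter> J. emeasure (?N j) (F j)) * (\<Prod>j\<in>K - J. emeasure (?N j) (F j))"
      using F' by (intro arg_cong2[where f="(*)"] prod.cong) auto
    also have "\<dots> = (\<Prod>j\<in>K. emeasure (?N j) (F j))"
      by (rule prod.Int_Diff[OF K(1), symmetric])
    also have "\<dots> = emeasure (PiM I ?N) (prod_emb I ?N K (Pi\<^sub>E K F))"
      using K F yi by (intro Infinite_Product_Measure.emeasure_PiM_emb[symmetric])
        (auto intro: prob_space_return M.prob_space_axioms)
    finally show "emeasure ?D (prod_emb I ?N K (Pi\<^sub>E K F)) =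
        emeasure (PiM I ?N) (prod_emb I ?N K (Pi\<^sub>E K F))"
      by (simp add: emb_N)
  qed (simp_all add: sets_N)
qed

end

section \<open>Approximation by functions of finitely many coordinates\<close>

context product_prob_space
begin

definition determined_by :: "'i set \<Rightarrow> (('i \<Rightarrow> 'a) \<Rightarrow> real) \<Rightarrow> bool" where
  "determined_by J g \<longleftrightarrow>
     (\<forall>x\<in>space (PiM I M). \<forall>y\<in>space (PiM I M). (\<forall>i\<in>J. x i = y i) \<longrightarrow> g x = g y)"

text \<open>Membership in the \<open>L\<^sup>1\<close>-closure of the integrable functions of finitely many coordinates.\<close>

definition finitely_approximable :: "(('i \<Rightarrow> 'a) \<Rightarrow> real) \<Rightarrow> bool" where
  "finitely_approximable f \<longleftrightarrow>
     integrable (PiM I M) f \<and>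
     (\<forall>e>0. \<exists>J g. finite J \<and> determined_by J g \<and> integrable (PiM I M) g \<and>
        (\<integral>x. \<bar>f x - g x\<bar> \<partial>PiM I M) < e)"

lemma determined_by_mono: "determined_by J g \<Longrightarrow> J \<subseteq> K \<Longrightarrow> determined_by K g"
  unfolding determined_by_def by blast

lemma finitely_approximable_determined:
  assumes "finite J" "determined_by J g" "integrable (PiM I M) g"
  shows "finitely_approximable g"
  unfolding finitely_approximable_def using assms by (auto intro!: exI[of _ J] exI[of _ g])

text \<open>
  Composing two approximations with a Lipschitz operation \<open>h\<close> multiplies the error by at most the
  Lipschitz constant.  The cases of interest are sums, scalar multiples, \<open>1 - a\<close> (complements of
  events) and \<open>max\<close> (unions of events).
\<close>

lemma finitely_approximable_Lipschitz:
  fixes h :: "real \<Rightarrow> real \<Rightarrow> real"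
  assumes f: "finitely_approximable f" "finitely_approximable g"
    and Lip: "\<And>a b a' b'. \<bar>h a b - h a' b'\<bar> \<le> C * (\<bar>a - a'\<bar> + \<bar>b - b'\<bar>)"
    and int: "\<And>f g. integrable (PiM I M) f \<Longrightarrow> integrable (PiM I M) g \<Longrightarrow>
                integrable (PiM I M) (\<lambda>x. h (f x) (g x))"
  shows "finitely_approximable (\<lambda>x. h (f x) (g x))"
  unfolding finitely_approximable_def
proof (intro conjI allI impI)
  have [simp]: "integrable (PiM I M) f" "integrable (PiM I M) g"
    using f unfolding finitely_approximable_def by auto
  show "integrable (PiM I M) (\<lambda>x. h (f x) (g x))"
    by (rule int) simp_all
  fix e :: real assume e: "e > 0"
  \<comment> \<open>\<open>C\<close> may be \<open>0\<close>, and \<open>\<bar>C\<bar> + 1\<close> is a positive Lipschitz constant.\<close>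
  define d where "d = e / (\<bar>C\<bar> + 1) / 2"
  have "\<bar>C\<bar> + 1 > 0"
    by simp
  with e have d: "d > 0" and Cd: "(\<bar>C\<bar> + 1) * (d + d) = e"
    by (simp_all only: d_def field_sum_of_halves) simp_all
  obtain J f' where J: "finite J" "determined_by J f'" and [simp]: "integrable (PiM I M) f'"
    and f': "(\<integral>x. \<bar>f x - f' x\<bar> \<partial>PiM I M) < d"
    using f(1) d unfolding finitely_approximable_def by blast
  obtain K g' where K: "finite K" "determined_by K g'" and [simp]: "integrable (PiM I M) g'"
    and g': "(\<integral>x. \<bar>g x - g' x\<bar> \<partial>PiM I M) < d"
    using f(2) d unfolding finitely_approximable_def by blast
  have "(\<integral>x. \<bar>h (f x) (g x) - h (f' x) (g' x)\<bar> \<partial>PiM I M)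
      \<le> (\<integral>x. (\<bar>C\<bar> + 1) * (\<bar>f x - f' x\<bar> + \<bar>g x - g' x\<bar>) \<partial>PiM I M)"
  proof (intro integral_mono)
    fix x
    have "C * (\<bar>f x - f' x\<bar> + \<bar>g x - g' x\<bar>) \<le> (\<bar>C\<bar> + 1) * (\<bar>f x - f' x\<bar> + \<bar>g x - g' x\<bar>)"
      by (intro mult_right_mono) auto
    then show "\<bar>h (f x) (g x) - h (f' x) (g' x)\<bar> \<le> (\<bar>C\<bar> + 1) * (\<bar>f x - f' x\<bar> + \<bar>g x - g' x\<bar>)"
      using Lip[of "f x" "g x" "f' x" "g' x"] by linarith
  qed (auto intro!: int integrable_abs Bochner_Integration.integrable_diff)
  also have "\<dots> = (\<bar>C\<bar> + 1) * ((\<integral>x. \<bar>f x - f' x\<bar> \<partial>PiM I M) + (\<integral>x. \<bar>g x - g' x\<bar> \<partial>PiM I M))"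
    by (simp add: Bochner_Integration.integral_add)
  also have "\<dots> < e"
    unfolding Cd[symmetric] using f' g' by (intro mult_strict_left_mono) auto
  finally have "(\<integral>x. \<bar>h (f x) (g x) - h (f' x) (g' x)\<bar> \<partial>PiM I M) < e" .
  moreover have "determined_by (J \<union> K) (\<lambda>x. h (f' x) (g' x))"
    using J(2) K(2) unfolding determined_by_def by (metis UnCI)
  ultimately show "\<exists>J k. finite J \<and> determined_by J k \<and> integrable (PiM I M) k \<and>
      (\<integral>x. \<bar>h (f x) (g x) - k x\<bar> \<partial>PiM I M) < e"
    using J(1) K(1) int[of f' g']
    by (intro exI[of _ "J \<union> K"] exI[of _ "\<lambda>x. h (f' x) (g' x)"]) simp
qed

lemma finitely_approximable_limit:
  assumes s: "\<And>n. finitely_approximable (s n)"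
    and lim: "\<And>x. x \<in> space (PiM I M) \<Longrightarrow> (\<lambda>n. s n x) \<longlonglongrightarrow> f x"
    and dom: "\<And>n x. x \<in> space (PiM I M) \<Longrightarrow> \<bar>s n x\<bar> \<le> w x" and w: "integrable (PiM I M) w"
  shows "finitely_approximable f"
  unfolding finitely_approximable_def
proof (intro conjI allI impI)
  have s_int [simp]: "integrable (PiM I M) (s n)" for n
    using s unfolding finitely_approximable_def by auto
  have f_meas: "f \<in> borel_measurable (PiM I M)"
    using lim by (rule borel_measurable_LIMSEQ_real) (auto intro: borel_measurable_integrable)
  show f_int [simp]: "integrable (PiM I M) f"
    by (rule integrable_dominated_convergence[where s=s and w=w])
      (use f_meas lim dom w in \<open>auto intro: borel_measurable_integrable\<close>)
  have f_bound: "\<bar>f x\<bar> \<le> w x" if x: "x \<in> space (PiM I M)" for x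
    using tendsto_rabs[OF lim[OF x]] by (rule LIMSEQ_le_const2) (auto intro: dom x)
  have "(\<lambda>n. \<integral>x. \<bar>f x - s n x\<bar> \<partial>PiM I M) \<longlonglongrightarrow> (\<integral>x. 0 \<partial>PiM I M)"
  proof (rule integral_dominated_convergence[where w="\<lambda>x. 2 * w x"])
    show "AE x in PiM I M. (\<lambda>n. \<bar>f x - s n x\<bar>) \<longlonglongrightarrow> 0"
    proof (rule AE_I2)
      fix x assume "x \<in> space (PiM I M)"
      then show "(\<lambda>n. \<bar>f x - s n x\<bar>) \<longlonglongrightarrow> 0"
        using tendsto_rabs[OF tendsto_diff[OF tendsto_const lim, of x "f x"]] by simp
    qed
    show "AE x in PiM I M. norm \<bar>f x - s n x\<bar> \<le> 2 * w x" for n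
      using f_bound dom by (intro AE_I2) (smt (verit) real_norm_def)
  qed (use w f_meas in \<open>auto intro!: borel_measurable_abs borel_measurable_diff borel_measurable_integrable\<close>)
  then have conv: "(\<lambda>n. \<integral>x. \<bar>f x - s n x\<bar> \<partial>PiM I M) \<longlonglongrightarrow> 0"
    by simp
  fix e :: real assume e: "e > 0"
  then have "eventually (\<lambda>n. (\<integral>x. \<bar>f x - s n x\<bar> \<partial>PiM I M) < e / 2) sequentially"
    by (intro order_tendstoD(2)[OF conv]) simp
  then obtain n where n: "(\<integral>x. \<bar>f x - s n x\<bar> \<partial>PiM I M) < e / 2"
    by (auto simp: eventually_sequentially)
  obtain J g where g: "finite J" "determined_by J g" and g_int [simp]: "integrable (PiM I M) g"
    and sg: "(\<integral>x. \<bar>s n x - g x\<bar> \<partial>PiM I M) < e / 2"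
    using s[of n] e unfolding finitely_approximable_def by (meson half_gt_zero)
  have "(\<integral>x. \<bar>f x - g x\<bar> \<partial>PiM I M) \<le> (\<integral>x. \<bar>f x - s n x\<bar> + \<bar>s n x - g x\<bar> \<partial>PiM I M)"
    by (intro integral_mono) auto
  also have "\<dots> < e"
    using n sg by (simp add: Bochner_Integration.integral_add)
  finally show "\<exists>J g. finite J \<and> determined_by J g \<and> integrable (PiM I M) g \<and>
      (\<integral>x. \<bar>f x - g x\<bar> \<partial>PiM I M) < e"
    using g g_int by blast
qed

lemma finitely_approximable_const: "finitely_approximable (\<lambda>x. c)"
  by (rule finitely_approximable_determined[of "{}"]) (auto simp: determined_by_def)

text \<open>
  The product sigma-algebra is generated by events about a single coordinate, and the events with
  approximable indicator form a sigma-algebra: a countable union is the bounded pointwise limit of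
  its finite subunions.
\<close>

lemma finitely_approximable_indicator:
  assumes "B \<in> sets (PiM I M)"
  shows "finitely_approximable (indicator B)"
  using assms unfolding sets_PiM_single
proof (induction rule: sigma_sets.induct)
  case (Basic B)
  then obtain i F where B: "B = {x \<in> \<Pi>\<^sub>E i\<in>I. space (M i). x i \<in> F}" "i \<in> I" "F \<in> sets (M i)"
    by auto
  then have "B = {x \<in> space (PiM I M). x i \<in> F}"
    by (simp add: space_PiM)
  also have "\<dots> \<in> sets (PiM I M)"
    using B by simp
  finally have "integrable (PiM I M) (indicator B :: _ \<Rightarrow> real)"
    by (simp add: P.emeasure_eq_measure)
  moreover have "determined_by {i} (indicator B)"
    by (auto simp: determined_by_def B(1) space_PiM indicator_def)
  ultimately show ?case
    by (intro finitely_approximable_determined[of "{i}"]) auto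
next
  case Empty
  then show ?case
    using finitely_approximable_const[of 0] by (simp add: indicator_def)
next
  case (Compl B)
  have "finitely_approximable (\<lambda>x. 1 - indicator B x)"
    using finitely_approximable_Lipschitz[OF Compl.IH Compl.IH, of "\<lambda>a b. 1 - a" 1] by simp
  \<comment> \<open>On the space, though not off it, this function is the indicator of the complement; a constant
      sequence converging to that indicator bridges the difference.\<close>
  then show ?case
    by (rule finitely_approximable_limit[where s="\<lambda>_::nat. _" and w="\<lambda>_. 1"])
      (auto simp: space_PiM indicator_def)
next
  case (Union B)
  have max: "finitely_approximable (\<lambda>x. max (f x) (g x))"
    if "finitely_approximable f" "finitely_approximable g" for f g
    using that by (rule finitely_approximable_Lipschitz[where C=1]) auto
  have fin: "finitely_approximable (indicator (\<Union>i<n. B i))" for n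
  proof (induction n)
    case 0
    then show ?case
      using finitely_approximable_const[of 0] by (simp add: indicator_def)
  next
    case (Suc n)
    have "indicator (\<Union>i<Suc n. B i) = (\<lambda>x. max (indicator (\<Union>i<n. B i) x) (indicator (B n) x) :: real)"
      by (auto simp: indicator_def less_Suc_eq fun_eq_iff)
    then show ?case
      using max[OF Suc Union.IH[of n]] by simp
  qed
  show ?case
  proof (rule finitely_approximable_limit[OF fin, where w="\<lambda>_. 1"])
    show "(\<lambda>n. indicator (\<Union>i<n. B i) x) \<longlonglongrightarrow> (indicator (\<Union>i. B i) x :: real)" for x
      by (rule LIMSEQ_indicator_UN)
    show "\<bar>indicator (\<Union>i<n. B i) x\<bar> \<le> (1 :: real)" for n x
      by (simp add: indicator_def)
  qed simp
qed

lemma integrable_imp_finitely_approximable: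
  assumes "integrable (PiM I M) f"
  shows "finitely_approximable f"
  using assms
proof (induction rule: integrable_induct)
  case (base B c)
  have "\<bar>a * c - a' * c\<bar> \<le> \<bar>c\<bar> * (\<bar>a - a'\<bar> + \<bar>b - b'\<bar>)" for a b a' b'
    unfolding left_diff_distrib[symmetric] abs_mult
    by (subst mult.commute) (intro mult_left_mono, auto)
  from finitely_approximable_Lipschitz[OF finitely_approximable_indicator[OF base(1)]
      finitely_approximable_indicator[OF base(1)] this]
  show ?case
    by simp
next
  case (add f g)
  show ?case
    using add.IH by (rule finitely_approximable_Lipschitz[where C=1]) auto
next
  case (lim f s)
  show ?case
    by (rule finitely_approximable_limit[where s=s and w="\<lambda>x. 2 * \<bar>f x\<bar>"])
      (use lim in auto)
qed

end

section \<open>Freezing all but finitely many coordinates\<close>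

text \<open>
  The distance between the two expectations is at most the error of the approximation before
  freezing plus the error after it.  Averaged over \<open>y\<close>, the latter equals the former, so it is small
  for some \<open>y\<close>.  Applying this to the sum \<open>w\<close> of the errors over all of \<open>A\<close> yields one \<open>y\<close> that
  works for every \<open>a\<close>.
\<close>

lemma (in product_prob_space) exists_point_freezing_preserves_expectations:
  fixes u :: "'b \<Rightarrow> ('i \<Rightarrow> 'a) \<Rightarrow> real" and B e :: real
  assumes "finite A"
    and meas: "\<And>a. a \<in> A \<Longrightarrow> u a \<in> borel_measurable (PiM I M)"
    and bdd: "\<And>a x. a \<in> A \<Longrightarrow> x \<in> space (PiM I M) \<Longrightarrow> \<bar>u a x\<bar> \<le> B"
    and "e > 0"
  obtains J y where "finite J" "y \<in> space (PiM I M)"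
    "\<And>a. a \<in> A \<Longrightarrow>
       \<bar>(\<integral>x. u a (override_on y x J) \<partial>PiM I M) - (\<integral>x. u a x \<partial>PiM I M)\<bar> < e"
proof -
  let ?P = "PiM I M"
  \<comment> \<open>With this error per function, the sum of all errors is below \<open>e / 2\<close>, even for empty \<open>A\<close>.\<close>
  define d where "d = e / 2 / (real (card A) + 1)"
  have "real (card A) + 1 > 0"
    by simp
  with \<open>e > 0\<close> have d: "d > 0" and Ad: "(real (card A) + 1) * d = e / 2"
    by (simp_all add: d_def del: divide_divide_eq_left)
  have u_int: "integrable ?P (u a)" if "a \<in> A" for a
    using bdd[OF that] by (intro P.integrable_const_bound[where B=B] AE_I2 meas that) auto
  have "\<exists>J g. finite J \<and> determined_by J g \<and> integrable ?P g \<and> (\<integral>x. \<bar>u a x - g x\<bar> \<partial>?P) < d"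
    if "a \<in> A" for a
    using integrable_imp_finitely_approximable[OF u_int[OF that]] d
    unfolding finitely_approximable_def by blast
  then obtain Js g where Js: "\<And>a. a \<in> A \<Longrightarrow> finite (Js a)" "\<And>a. a \<in> A \<Longrightarrow> determined_by (Js a) (g a)"
    and g_int: "\<And>a. a \<in> A \<Longrightarrow> integrable ?P (g a)"
    and g_close: "\<And>a. a \<in> A \<Longrightarrow> (\<integral>x. \<bar>u a x - g a x\<bar> \<partial>?P) < d"
    by metis
  define J where "J = (\<Union>a\<in>A. Js a)"
  have J: "finite J" and g_J: "\<And>a. a \<in> A \<Longrightarrow> determined_by J (g a)"
    using Js \<open>finite A\<close> by (auto simp: J_def intro: determined_by_mono)
  define w where "w x = (\<Sum>a\<in>A. \<bar>u a x - g a x\<bar>)" for x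
  have w_int: "integrable ?P w"
    unfolding w_def using u_int g_int by auto
  have w_meas [measurable]: "w \<in> borel_measurable ?P"
    using w_int by (rule borel_measurable_integrable)
  have w_nonneg: "w x \<ge> 0" for x
    by (simp add: w_def sum_nonneg)
  have "(\<integral>x. w x \<partial>?P) = (\<Sum>a\<in>A. \<integral>x. \<bar>u a x - g a x\<bar> \<partial>?P)"
    unfolding w_def using u_int g_int by (intro Bochner_Integration.integral_sum) auto
  also have "\<dots> \<le> (\<Sum>a\<in>A. d)"
    using g_close by (intro sum_mono less_imp_le)
  also have "\<dots> < e / 2"
    unfolding Ad[symmetric] using d by (simp add: algebra_simps)
  finally have w_small: "(\<integral>x. w x \<partial>?P) < e / 2" .

  \<comment> \<open>Nonnegative integrals make sense for every \<open>y\<close>; the inner Bochner integral could be a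
      meaningless \<open>0\<close> for a null set of \<open>y\<close>, which might contain the chosen one.\<close>
  have "(\<integral>\<^sup>+y. \<integral>\<^sup>+x. ennreal (w (override_on y x J)) \<partial>?P \<partial>?P) =
        (\<integral>\<^sup>+p. ennreal (w (override_on (fst p) (snd p) J)) \<partial>(?P \<Otimes>\<^sub>M ?P))"
    by (subst P.nn_integral_fst[symmetric]) simp_all
  also have "\<dots> = (\<integral>\<^sup>+x. ennreal (w x) \<partial>?P)"
    by (subst (2) distr_override_on_pair[of J, symmetric]) (simp add: nn_integral_distr)
  also have "\<dots> = ennreal (\<integral>x. w x \<partial>?P)"
    by (intro nn_integral_eq_integral w_int AE_I2 w_nonneg)
  also have "\<dots> < ennreal (e / 2)"
    using w_small \<open>e > 0\<close> by (simp add: ennreal_lessI)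
  finally have avg: "(\<integral>\<^sup>+y. \<integral>\<^sup>+x. ennreal (w (override_on y x J)) \<partial>?P \<partial>?P) < ennreal (e / 2)" .
  have "\<exists>y\<in>space ?P. (\<integral>\<^sup>+x. ennreal (w (override_on y x J)) \<partial>?P) < ennreal (e / 2)"
  proof (rule ccontr)
    assume "\<not> ?thesis"
    then have "(\<integral>\<^sup>+y. ennreal (e / 2) \<partial>?P) \<le>
        (\<integral>\<^sup>+y. \<integral>\<^sup>+x. ennreal (w (override_on y x J)) \<partial>?P \<partial>?P)"
      by (intro nn_integral_mono) (simp add: not_less)
    with avg show False
      by (simp add: P.emeasure_space_1 not_le[symmetric])
  qed
  then obtain y where y: "y \<in> space ?P" and
    wy: "(\<integral>\<^sup>+x. ennreal (w (override_on y x J)) \<partial>?P) < ennreal (e / 2)"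
    by blast
  have ov_meas: "(\<lambda>x. override_on y x J) \<in> ?P \<rightarrow>\<^sub>M ?P"
    by (rule measurable_override_on_fixed[OF y])
  show thesis
  proof
    show "finite J" "y \<in> space ?P"
      by fact+
    fix a assume a: "a \<in> A"
    have uy_int: "integrable ?P (\<lambda>x. u a (override_on y x J))"
      using bdd[OF a override_on_in_space_PiM[OF _ y]]
      by (intro P.integrable_const_bound[where B=B] AE_I2 measurable_compose[OF ov_meas meas[OF a]])
        auto
    have gy: "g a (override_on y x J) = g a x" if "x \<in> space ?P" for x
      using g_J[OF a] that override_on_in_space_PiM[OF that y, of J]
      unfolding determined_by_def by (metis override_on_apply_in)
    have le_w: "\<bar>u a x - g a x\<bar> \<le> w x" for x
      unfolding w_def using a \<open>finite A\<close> by (intro member_le_sum) auto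
    have "ennreal \<bar>\<integral>x. u a (override_on y x J) - g a x \<partial>?P\<bar>
        \<le> (\<integral>\<^sup>+x. ennreal (w (override_on y x J)) \<partial>?P)"
    proof (rule order_trans)
      show "ennreal \<bar>\<integral>x. u a (override_on y x J) - g a x \<partial>?P\<bar>
          \<le> (\<integral>\<^sup>+x. ennreal \<bar>u a (override_on y x J) - g a x\<bar> \<partial>?P)"
        using integral_norm_bound_ennreal[OF Bochner_Integration.integrable_diff[OF uy_int g_int[OF a]]]
        by simp
      show "\<dots> \<le> (\<integral>\<^sup>+x. ennreal (w (override_on y x J)) \<partial>?P)"
        by (intro nn_integral_mono ennreal_leI) (metis gy le_w)
    qed
    also note wy
    finally have "\<bar>\<integral>x. u a (override_on y x J) - g a x \<partial>?P\<bar> < e / 2"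
      using \<open>e > 0\<close> by (simp add: ennreal_less_iff)
    moreover have "\<bar>\<integral>x. u a x - g a x \<partial>?P\<bar> \<le> (\<integral>x. w x \<partial>?P)"
      using u_int[OF a] g_int[OF a] w_int le_w
      by (intro order_trans[OF integral_abs_bound] integral_mono) auto
    ultimately have
      "\<bar>(\<integral>x. u a (override_on y x J) \<partial>?P) - (\<integral>x. g a x \<partial>?P)\<bar> < e / 2"
      "\<bar>(\<integral>x. u a x \<partial>?P) - (\<integral>x. g a x \<partial>?P)\<bar> < e / 2"
      using w_small uy_int u_int[OF a] g_int[OF a] by simp_all
    then show "\<bar>(\<integral>x. u a (override_on y x J) \<partial>?P) - (\<integral>x. u a x \<partial>?P)\<bar> < e"
      unfolding abs_less_iff by linarith
  qed
qed

section \<open>The two minmax values coincide\<close>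

theorem theorem8:
  fixes A :: "'a set"
    and X :: "nat \<Rightarrow> 'x topology"
    and u :: "'a \<times> (nat \<Rightarrow> 'x) \<Rightarrow> real"
  assumes "finite A" and "A \<noteq> {}"
    and "\<And>i. polish_space (X i)"
    and "u \<in> borel_measurable
               (borel_of (prod_topology (discrete_topology A) (product_topology X UNIV)))"
    and "bounded (u ` (A \<times> topspace (product_topology X UNIV)))"
  shows "minmax_value A X u = finitistic_minmax_value A X u"
proof -
  let ?T = "product_topology X UNIV"
  let ?E = "\<lambda>\<sigma>. MAX a\<in>A. expected_payoff A u a \<sigma>"
  let ?S = "product_measures X" and ?F = "finitistic_product_measures X"
  have FS: "?F \<subseteq> ?S"
    unfolding finitistic_product_measures_def product_measures_def by blast
  obtain B where B: "\<And>a x. a \<in> A \<Longrightarrow> x \<in> topspace ?T \<Longrightarrow> \<bar>u (a, x)\<bar> \<le> B"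
    using assms(5) unfolding bounded_iff by fastforce
  have payoff: "expected_payoff A u a \<sigma> = (\<integral>x. u (a, x) \<partial>\<sigma>)" if "a \<in> A" "\<sigma> \<in> ?S" for a \<sigma>
    using expected_payoff_eq[OF assms(1) that(1) assms(3-5) that(2)] .
  have prob: "prob_space \<sigma>" and space: "space \<sigma> = topspace ?T"
    and slice: "a \<in> A \<Longrightarrow> (\<lambda>x. u (a, x)) \<in> borel_measurable \<sigma>" if \<sigma>: "\<sigma> \<in> ?S" for \<sigma> a
  proof -
    obtain s where s: "\<sigma> = PiM UNIV s" "\<And>i. prob_space (s i)" "\<And>i. sets (s i) = sets (borel_of (X i))"
      using \<sigma> unfolding product_measures_def borel_prob_measures_def by auto
    show "prob_space \<sigma>"
      unfolding s(1) by (rule prob_space_PiM) (rule s(2))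
    have sets: "sets \<sigma> = sets (borel_of ?T)"
      unfolding s(1) by (rule sets_PiM_eq_borel_of_product) (auto simp: assms(3) s(3))
    then show "space \<sigma> = topspace ?T"
      by (metis sets_eq_imp_space_eq space_borel_of)
    assume a: "a \<in> A"
    have "continuous_map ?T (prod_topology (discrete_topology A) ?T) (\<lambda>x. (a, x))"
      using a by (intro continuous_map_pairedI) auto
    then have "(\<lambda>x. u (a, x)) \<in> borel_measurable (borel_of ?T)"
      using measurable_compose[OF continuous_map_measurable_borel_of assms(4)] by blast
    then show "(\<lambda>x. u (a, x)) \<in> borel_measurable \<sigma>"
      using measurable_cong_sets[OF sets refl] by blast
  qed
  have lower: "- B \<le> ?E \<sigma>" if \<sigma>: "\<sigma> \<in> ?S" for \<sigma>
  proof -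
    interpret prob_space \<sigma>
      by (rule prob[OF \<sigma>])
    obtain a where a: "a \<in> A"
      using assms(2) by blast
    have "- B \<le> (\<integral>x. u (a, x) \<partial>\<sigma>)"
    proof (rule integral_ge_const)
      show "integrable \<sigma> (\<lambda>x. u (a, x))"
        by (rule integrable_const_bound[where B=B])
          (use B[OF a] slice[OF \<sigma> a] in \<open>auto simp: space[OF \<sigma>] simp del: topspace_product_topology\<close>)
      show "AE x in \<sigma>. - B \<le> u (a, x)"
        using B[OF a] by (intro AE_I2) (fastforce simp: space[OF \<sigma>] abs_le_iff simp del: topspace_product_topology)
    qed
    also have "\<dots> \<le> ?E \<sigma>"
      using a assms(1) unfolding payoff[OF a \<sigma>, symmetric] by (intro Max_ge) auto
    finally show ?thesis .
  qed
  have bdd: "bdd_below (?E ` ?S)" "bdd_below (?E ` ?F)"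
    using lower FS by (auto intro!: bdd_belowI2[where m="- B"])
  have close: "\<exists>\<tau>\<in>?F. ?E \<tau> \<le> ?E \<sigma> + e" if \<sigma>: "\<sigma> \<in> ?S" and e: "e > 0" for \<sigma> e
  proof -
    obtain s where s: "\<sigma> = PiM UNIV s" "\<And>i. prob_space (s i)" "\<And>i. sets (s i) = sets (borel_of (X i))"
      using \<sigma> unfolding product_measures_def borel_prob_measures_def by auto
    interpret product_prob_space s UNIV
      by (intro product_prob_spaceI s(2))
    obtain J y where J: "finite J" and y: "y \<in> space (PiM UNIV s)" and
      near: "\<And>a. a \<in> A \<Longrightarrow>
        \<bar>(\<integral>x. u (a, override_on y x J) \<partial>PiM UNIV s) - (\<integral>x. u (a, x) \<partial>PiM UNIV s)\<bar> < e"
      using exists_point_freezing_preserves_expectations[of A "\<lambda>a x. u (a, x)" B e]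
        assms(1) slice[OF \<sigma>] B e unfolding s(1) space[OF \<sigma>, unfolded s(1), symmetric] by blast
    define t where "t i = (if i \<in> J then s i else return (s i) (y i))" for i
    have yi: "y i \<in> topspace (X i)" for i
      using y sets_eq_imp_space_eq[OF s(3), of i] by (auto simp: space_PiM)
    have t: "t i \<in> borel_prob_measures (X i)" for i
      using s(2,3) yi[of i] sets_eq_imp_space_eq[OF s(3), of i]
      by (auto simp: t_def borel_prob_measures_def intro: prob_space_return)
    have "t i \<in> dirac_measures (X i)" if "i \<notin> J" for i
      using that yi[of i] return_cong[OF s(3)[of i]] by (auto simp: t_def dirac_measures_def)
    then have "{i. t i \<notin> dirac_measures (X i)} \<subseteq> J"
      by blast
    then have tF: "PiM UNIV t \<in> ?F"
      using t finite_subset[OF _ J] unfolding finitistic_product_measures_def by blast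
    have law: "PiM UNIV t = distr (PiM UNIV s) (PiM UNIV s) (\<lambda>x. override_on y x J)"
      unfolding t_def by (rule distr_override_on_fixed[OF y, symmetric])
    have "expected_payoff A u a (PiM UNIV t) \<le> expected_payoff A u a \<sigma> + e" if a: "a \<in> A" for a
    proof -
      have "(\<integral>x. u (a, x) \<partial>PiM UNIV t) = (\<integral>x. u (a, override_on y x J) \<partial>PiM UNIV s)"
        unfolding law using slice[OF \<sigma> a] unfolding s(1)
        by (intro integral_distr measurable_override_on_fixed y)
      then show ?thesis
        using near[OF a] payoff[OF a \<sigma>] payoff[OF a, of "PiM UNIV t"] tF FS
        unfolding s(1) by auto
    qed
    then have "expected_payoff A u a (PiM UNIV t) \<le> ?E \<sigma> + e" if "a \<in> A" for a
      using that assms(1) by (intro order_trans[OF _ add_right_mono[OF Max_ge]]) auto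
    then have "?E (PiM UNIV t) \<le> ?E \<sigma> + e"
      using assms(1,2) by (intro Max.boundedI) auto
    then show ?thesis
      using tF by blast
  qed
  \<comment> \<open>If some \<open>X i\<close> is empty, there are no product measures; both values are then the same
      unspecified infimum of the empty set.\<close>
  show ?thesis
  proof (cases "?S = {}")
    case True
    then have "?F = {}"
      using FS by blast
    with True show ?thesis
      unfolding minmax_value_def finitistic_minmax_value_def by simp
  next
    case False
    then have F_ne: "?F \<noteq> {}"
      using close[of _ 1] by force
    show ?thesis
    proof (rule antisym)
      show "minmax_value A X u \<le> finitistic_minmax_value A X u"
        unfolding minmax_value_def finitistic_minmax_value_def
        by (rule cINF_superset_mono[OF F_ne bdd(1) FS]) simp
      show "finitistic_minmax_value A X u \<le> minmax_value A X u"
        unfolding minmax_value_def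
      proof (rule cINF_greatest[OF False], rule field_le_epsilon)
        fix \<sigma> and e :: real assume \<sigma>: "\<sigma> \<in> ?S" and e: "0 < e"
        obtain \<tau> where "\<tau> \<in> ?F" "?E \<tau> \<le> ?E \<sigma> + e"
          using close[OF \<sigma> e] by blast
        then show "finitistic_minmax_value A X u \<le> ?E \<sigma> + e"
          unfolding finitistic_minmax_value_def by (rule cINF_lower2[OF bdd(2)])
      qed
    qed
  qed
qed

end
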